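(* Let $\mathbf u=(u_n)_{n\in\mathbb N}$ be an arithmetic sequence, let $\mathcal I$ be a translation invariant free $P$-ideal of $\mathbb N$ such that every $b$-bounded subset of $\mathbb N$ belongs to $\mathcal I$ (i.e. $\mathcal B_{\mathbf u}\subseteq\mathcal I$), and let $x\in[0,1)$. Then $\bar x\in t^{\mathcal I}_{\mathbf u}(\mathbb T)$ if and only if for every $b$-divergent $A\in\mathcal P(\mathbb N)\setminus\mathcal I$ there exists $B\subseteq_{\mathcal I}A$ such that $\lim_{n\in B}\varphi\left(\frac{c_n}{b_n}\right)=0$ in $\mathbb T$.
   Context: $\mathbb N=\{0,1,2,\dots\}$, $\mathbb N_+=\mathbb N\setminus\{0\}$; $\mathbb T=\mathbb R/\mathbb Z$ with canonical projection $\varphi\colon\mathbb R\to\mathbb T$, and $\bar x=\varphi(x)$. For $A\subseteq\mathbb N$ and $n\in\mathbb Z$, $A+n=\{a+n:a\in A\}$. For an infinite $A\subseteq\mathbb N$, $\lim_{n\in A}$ is the limit as $n\to\infty$ along $A$. An ideal of $\mathbb N$ is a non-empty $\mathcal I\subseteq\mathcal P(\mathbb N)$ closed under finite unions and subsets. It is free if it contains all finite subsets of $\mathbb N$; translation invariant if $(A+n)\cap\mathbb N\in\mathcal I$ for all $A\in\mathcal I$, $n\in\mathbb Z$; a $P$-ideal if for every countable family $\{A_n:n\in\mathbb N\}\subseteq\mathcal I$ there is $U\in\mathcal I$ with $A_n\setminus U$ finite for all $n$. Write $A\subseteq_{\mathcal I}B$ if $A\subseteq B$ and $B\setminus A\in\mathcal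 I$. A sequence $(x_n)$ in $\mathbb T$ $\mathcal I$-converges to $y$ if $\{n\in\mathbb N:x_n\notin U\}\in\mathcal I$ for every neighborhood $U$ of $y$; $t^{\mathcal I}_{\mathbf u}(\mathbb T)=\{y\in\mathbb T: u_ny \ \mathcal I\text{-converges to }0\}$. A sequence $\mathbf u=(u_n)_{n\in\mathbb N}$ of integers is arithmetic if it is strictly increasing, $u_0=1$ and $u_n\mid u_{n+1}$ for all $n\in\mathbb N$; put $b_n=u_n/u_{n-1}$ for $n\in\mathbb N_+$. Every $x\in[0,1)$ has a unique representation $x=\sum_{n=1}^\infty\frac{c_n}{u_n}$ with $c_n\in\mathbb N$, $c_n<b_n$ for all $n\in\mathbb N_+$ and $c_n<b_n-1$ for infinitely many $n$. An infinite $A\subseteq\mathbb N$ is $b$-bounded if $(b_n)_{n\in A}$ is bounded, and $b$-divergent if $(b_n)_{n\in A}$ diverges to infinity (finite sets are regarded as both). $\mathcal B_{\mathbf u}$ is the family of all $b$-bounded subsets together with all finite subsets of $\mathbb N$. The index $n=0$, for which $b_n$ and $c_n$ are not defined, is disregarded in these conditions and in limits. *)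

theory Defs
  imports Complex_Main
begin

section \<open>The circle group \<open>\<real>/\<int>\<close>\<close>

quotient_type circle = real / "\<lambda>x y. x - y \<in> \<int>"
  morphisms rep_circle abs_circle
proof (rule equivpI)
  show "reflp (\<lambda>x y::real. x - y \<in> \<int>)"
    by (simp add: reflp_def)
  show "symp (\<lambda>x y::real. x - y \<in> \<int>)"
    unfolding symp_def using Ints_minus by fastforce
  show "transp (\<lambda>x y::real. x - y \<in> \<int>)"
    unfolding transp_def using Ints_add by fastforce
qed

lift_definition proj :: "real \<Rightarrow> circle" is "\<lambda>x. x" .

instantiation circle :: ab_group_add
begin

lift_definition zero_circle :: circle is "0" .

lift_definition plus_circle :: "circle \<Rightarrow> circle \<Rightarrow> circle" is "(+)"
  by (metis Ints_add add_diff_add)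

lift_definition uminus_circle :: "circle \<Rightarrow> circle" is "uminus"
  by (metis Ints_minus minus_diff_commute minus_diff_eq uminus_add_conv_diff diff_minus_eq_add)

lift_definition minus_circle :: "circle \<Rightarrow> circle \<Rightarrow> circle" is "(-)"
  by (metis Ints_diff diff_diff_eq2 add_diff_eq diff_add_eq diff_diff_add add.commute)

instance
  by standard (transfer; simp)+

end

instantiation circle :: topological_space
begin

definition open_circle :: "circle set \<Rightarrow> bool"
  where "open_circle U \<longleftrightarrow> open (proj -` U)"

instance
  by standard (auto simp: open_circle_def vimage_Union)

end

lift_definition int_mult :: "int \<Rightarrow> circle \<Rightarrow> circle" is "\<lambda>k x. of_int k * x"
  by (metis Ints_mult Ints_of_int right_diff_distrib)

text \<open>The next two facts determine \<^const>\<open>int_mult\<close>: it is the \<open>\<int>\<close>-module structure of the group.\<close>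

lemma int_mult_one: "int_mult 1 y = y"
  by transfer simp

lemma int_mult_add: "int_mult (k + l) y = int_mult k y + int_mult l y"
  by transfer (simp add: algebra_simps)

section \<open>Ideals of \<open>\<nat>\<close>\<close>

definition is_ideal :: "nat set set \<Rightarrow> bool"
  where "is_ideal I \<longleftrightarrow> I \<noteq> {} \<and> (\<forall>A\<in>I. \<forall>B\<in>I. A \<union> B \<in> I) \<and> (\<forall>A\<in>I. \<forall>B. B \<subseteq> A \<longrightarrow> B \<in> I)"

definition free_ideal :: "nat set set \<Rightarrow> bool"
  where "free_ideal I \<longleftrightarrow> is_ideal I \<and> (\<forall>F. finite F \<longrightarrow> F \<in> I)"

text \<open>\<open>(A + n) \<inter> \<nat>\<close> for an integer \<open>n\<close>.\<close>

definition shift :: "nat set \<Rightarrow> int \<Rightarrow> nat set"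
  where "shift A n = {m. \<exists>a\<in>A. int m = int a + n}"

definition translation_invariant :: "nat set set \<Rightarrow> bool"
  where "translation_invariant I \<longleftrightarrow> (\<forall>A\<in>I. \<forall>n. shift A n \<in> I)"

definition P_ideal :: "nat set set \<Rightarrow> bool"
  where "P_ideal I \<longleftrightarrow> is_ideal I \<and>
    (\<forall>A :: nat \<Rightarrow> nat set. (\<forall>n. A n \<in> I) \<longrightarrow> (\<exists>U\<in>I. \<forall>n. finite (A n - U)))"

definition subset_mod :: "nat set set \<Rightarrow> nat set \<Rightarrow> nat set \<Rightarrow> bool"
  where "subset_mod I A B \<longleftrightarrow> A \<subseteq> B \<and> B - A \<in> I"

definition ideal_converges :: "nat set set \<Rightarrow> (nat \<Rightarrow> 'a::topological_space) \<Rightarrow> 'a \<Rightarrow> bool"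
  where "ideal_converges I x y \<longleftrightarrow>
    (\<forall>U. (\<exists>V. open V \<and> y \<in> V \<and> V \<subseteq> U) \<longrightarrow> {n. x n \<notin> U} \<in> I)"

definition t_set :: "nat set set \<Rightarrow> (nat \<Rightarrow> int) \<Rightarrow> circle set"
  where "t_set I u = {y. ideal_converges I (\<lambda>n. int_mult (u n) y) 0}"

text \<open>The filter describing \<open>n \<rightarrow> \<infinity>\<close> along \<open>A\<close>. It is trivial (every limit statement holds) when
  \<open>A\<close> is finite.\<close>

definition along :: "nat set \<Rightarrow> nat filter"
  where "along A = inf sequentially (principal A)"

section \<open>Arithmetic sequences\<close>

definition arithmetic_seq :: "(nat \<Rightarrow> int) \<Rightarrow> bool"
  where "arithmetic_seq u \<longleftrightarrow> strict_mono u \<and> u 0 = 1 \<and> (\<forall>n. u n dvd u (Suc n))"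

text \<open>Only meaningful for \<open>n \<ge> 1\<close>; the value at \<open>0\<close> is junk and is disregarded below.\<close>

definition ratio :: "(nat \<Rightarrow> int) \<Rightarrow> nat \<Rightarrow> int"
  where "ratio u n = u n div u (n - 1)"

text \<open>\<open>c\<close> is the canonical digit sequence of \<open>x\<close> with respect to \<open>u\<close>; \<open>c 0\<close> is unconstrained.\<close>

definition canonical_digits :: "(nat \<Rightarrow> int) \<Rightarrow> real \<Rightarrow> (nat \<Rightarrow> nat) \<Rightarrow> bool"
  where "canonical_digits u x c \<longleftrightarrow>
    (\<forall>n\<ge>1. int (c n) < ratio u n) \<and>
    infinite {n. n \<ge> 1 \<and> int (c n) < ratio u n - 1} \<and>
    (\<lambda>n. real (c (Suc n)) / real_of_int (u (Suc n))) sums x"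

definition b_bounded :: "(nat \<Rightarrow> int) \<Rightarrow> nat set \<Rightarrow> bool"
  where "b_bounded u A \<longleftrightarrow> finite A \<or> (\<exists>M. \<forall>n\<in>A. n \<ge> 1 \<longrightarrow> ratio u n \<le> M)"

definition b_divergent :: "(nat \<Rightarrow> int) \<Rightarrow> nat set \<Rightarrow> bool"
  where "b_divergent u A \<longleftrightarrow> finite A \<or> filterlim (ratio u) at_top (along A)"

definition bounded_sets :: "(nat \<Rightarrow> int) \<Rightarrow> nat set set"
  where "bounded_sets u = {A. b_bounded u A} \<union> {A. finite A}"

text \<open>Every \<open>x \<in> [0,1)\<close> has canonical digits: the partial sums of the series below are
  \<open>\<lfloor>u\<^sub>n x\<rfloor> / u\<^sub>n\<close>.\<close>

lemma canonical_digits_exist: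
  assumes u: "arithmetic_seq u" and x: "0 \<le> x" "x < 1"
  shows "\<exists>c. canonical_digits u x c"
proof -
  have sm: "strict_mono u" and u0: "u 0 = 1" and dv: "u n dvd u (Suc n)" for n
    using u by (auto simp: arithmetic_seq_def)
  have ge: "u n \<ge> int n + 1" for n
  proof (induction n)
    case (Suc n)
    have "u n < u (Suc n)" using sm by (simp add: strict_mono_Suc_iff)
    then show ?case using Suc by simp
  qed (simp add: u0)
  have pos: "u n > 0" for n using ge[of n] by linarith
  have rat: "u (Suc n) = ratio u (Suc n) * u n" for n
    using dv[of n] by (simp add: ratio_def)
  have rpos: "ratio u (Suc n) > 0" for n
    using rat[of n] pos[of n] pos[of "Suc n"] by (metis zero_less_mult_pos2)
  define f where "f n = \<lfloor>of_int (u n) * x\<rfloor>" for n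
  define d where "d n = f n - ratio u n * f (n - 1)" for n
  have fb: "of_int (f n) \<le> of_int (u n) * x" "of_int (u n) * x < of_int (f n) + 1" for n
    unfolding f_def by linarith+
  have d0: "d (Suc n) \<ge> 0" and d1: "d (Suc n) < ratio u (Suc n)" for n
  proof -
    let ?r = "ratio u (Suc n)"
    have r: "real_of_int ?r > 0" using rpos[of n] by simp
    have e: "of_int (u (Suc n)) * x = of_int ?r * (of_int (u n) * x)"
      using rat[of n] by simp
    have "real_of_int (?r * f n) \<le> of_int (u (Suc n)) * x"
      using fb(1)[of n] r unfolding e by simp
    then have "?r * f n \<le> f (Suc n)" unfolding f_def by linarith
    then show "d (Suc n) \<ge> 0" by (simp add: d_def)
    have "of_int (u (Suc n)) * x < of_int ?r * (of_int (f n) + 1)"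
      unfolding e using fb(2)[of n] r by (rule mult_strict_left_mono)
    then have "real_of_int (f (Suc n)) < real_of_int (?r * (f n + 1))"
      using fb(1)[of "Suc n"] by simp
    then have "f (Suc n) < ?r * (f n + 1)" by (simp only: of_int_less_iff)
    then show "d (Suc n) < ?r" by (simp add: d_def algebra_simps)
  qed
  define c where "c n = nat (d n)" for n
  have c: "int (c (Suc n)) = d (Suc n)" for n using d0 by (simp add: c_def)
  have step: "real (c (Suc n)) / u (Suc n) = f (Suc n) / u (Suc n) - f n / u n" for n
  proof -
    have "real (c (Suc n)) = of_int (d (Suc n))" by (metis c of_int_of_nat_eq)
    then show ?thesis
      using rpos[of n] pos[of n] by (simp add: d_def rat[of n] field_simps)
  qed
  have f0: "f 0 = 0" using x by (simp add: f_def u0 floor_eq_iff)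
  have part: "(\<Sum>k<n. real (c (Suc k)) / u (Suc k)) = f n / u n" for n
    by (induction n) (simp_all add: f0 step)
  have close: "\<bar>f n / u n - x\<bar> \<le> 1 / real (Suc n)" for n
  proof -
    have p: "real_of_int (u n) > 0" using pos by simp
    have "\<bar>f n / u n - x\<bar> = \<bar>f n - u n * x\<bar> / u n"
      using p by (simp add: field_simps abs_if)
    also have "\<dots> \<le> 1 / u n" using fb[of n] p by (intro divide_right_mono) auto
    also have "\<dots> \<le> 1 / real (Suc n)"
    proof (rule divide_left_mono)
      show "real (Suc n) \<le> real_of_int (u n)" using ge[of n] by linarith
    qed (use p in auto)
    finally show ?thesis .
  qed
  have lim: "(\<lambda>n. real_of_int (f n) / u n) \<longlonglongrightarrow> x"
  proof (rule LIM_zero_cancel)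
    show "(\<lambda>n. real_of_int (f n) / u n - x) \<longlonglongrightarrow> 0"
      by (rule tendsto_0_le[OF LIMSEQ_inverse_real_of_nat, where K = 1])
        (use close in \<open>auto simp: inverse_eq_divide\<close>)
  qed
  have "infinite {n. n \<ge> 1 \<and> int (c n) < ratio u n - 1}"
  proof
    assume "finite {n. n \<ge> 1 \<and> int (c n) < ratio u n - 1}"
    then obtain N where N: "\<And>n. n \<ge> 1 \<Longrightarrow> int (c n) < ratio u n - 1 \<Longrightarrow> n \<le> N"
      by (auto simp: finite_nat_set_iff_bounded_le)
    have top: "d (Suc n) = ratio u (Suc n) - 1" if "n \<ge> N" for n
      using N[of "Suc n"] that c[of n] d1[of n] by fastforce
    have const: "(f (N + k) + 1) / u (N + k) = (f N + 1) / u N" for k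
    proof (induction k)
      case (Suc k)
      have "f (Suc (N + k)) + 1 = ratio u (Suc (N + k)) * (f (N + k) + 1)"
        using top[of "N + k"] by (simp add: d_def algebra_simps)
      then have "(f (Suc (N + k)) + 1) / u (Suc (N + k)) = (f (N + k) + 1) / u (N + k)"
        using rpos[of "N + k"] by (simp add: rat[of "N + k"])
      then show ?case using Suc by simp
    qed simp
    have "(f N + 1) / u N - x \<le> 1 / real (Suc k)" for k
    proof -
      have "1 / real_of_int (u (N + k)) \<le> 1 / real (Suc k)"
      proof (rule divide_left_mono)
        show "real (Suc k) \<le> real_of_int (u (N + k))" using ge[of "N + k"] by linarith
      qed (use pos[of "N + k"] in auto)
      moreover have "f (N + k) / u (N + k) \<le> x"
        using fb(1)[of "N + k"] pos[of "N + k"] by (simp add: field_simps)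
      ultimately show ?thesis using const[of k] by (simp add: add_divide_distrib)
    qed
    moreover have "(\<lambda>k. 1 / real (Suc k)) \<longlonglongrightarrow> 0"
      using LIMSEQ_inverse_real_of_nat by (simp add: inverse_eq_divide)
    ultimately have "(f N + 1) / u N - x \<le> 0" using LIMSEQ_le_const by blast
    then show False using fb(2)[of N] pos[of N] by (simp add: field_simps)
  qed
  moreover have "int (c n) < ratio u n" if "n \<ge> 1" for n
    using that d1[of "n - 1"] c[of "n - 1"] by simp
  ultimately have "canonical_digits u x c"
    unfolding canonical_digits_def sums_def part using lim by simp
  then show ?thesis by blast
qed

end

theory Submission
  imports Defs
begin

text \<open>Modulo \<open>1\<close>, \<open>u\<^sub>n x\<close> equals \<open>c\<^sub>n\<^sub>+\<^sub>1 / b\<^sub>n\<^sub>+\<^sub>1\<close> up to an error in \<open>[0, 1 / b\<^sub>n\<^sub>+\<^sub>1]\<close>. Since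
  \<open>b\<^sub>n \<le> M\<close> only on a set of the ideal, the error tends to \<open>0\<close> along the dual filter, and by
  translation invariance \<open>x\<close> lies in the characterized subgroup iff \<open>c\<^sub>n / b\<^sub>n\<close> tends to \<open>0\<close> modulo
  \<open>1\<close> along the dual filter. By the \<open>P\<close>-property, convergence along the dual filter is ordinary
  convergence off a set of the ideal; this applies both to \<open>c\<^sub>n / b\<^sub>n\<close> and to \<open>b\<^sub>n \<rightarrow> \<infinity>\<close>, and the
  latter yields a \<open>b\<close>-divergent set whose complement is in the ideal.\<close>

section \<open>Convergence to zero in the circle\<close>

text \<open>Distance to the nearest integer, the quotient norm on the circle; it reduces limits to 0
  in the circle to limits of real functions.\<close>

definition int_dist :: "real \<Rightarrow> real"
  where "int_dist t = \<bar>t - of_int (round t)\<bar>"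

lemma int_dist_nonneg: "0 \<le> int_dist t"
  by (simp add: int_dist_def)

lemma int_dist_le: "int_dist t \<le> \<bar>t - of_int k\<bar>"
  unfolding int_dist_def by (rule round_diff_minimal)

text \<open>\<open>round t + k\<close> is an integer competing with the one nearest to
  \<open>s\<close>. The free \<open>k\<close> serves estimates that are known only modulo 1.\<close>

lemma int_dist_le_add: "int_dist s \<le> int_dist t + \<bar>s - t - of_int k\<bar>"
proof -
  have "int_dist s \<le> \<bar>s - of_int (round t + k)\<bar>"
    by (rule int_dist_le)
  also have "\<dots> \<le> int_dist t + \<bar>s - t - of_int k\<bar>"
    by (simp add: int_dist_def)
  finally show ?thesis .
qed

lemma abs_int_dist_diff_le: "\<bar>int_dist s - int_dist t\<bar> \<le> \<bar>s - t - of_int k\<bar>"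
  using int_dist_le_add[of s t k] int_dist_le_add[of t s "- k"] by auto

lemma proj_eq_iff: "proj s = proj t \<longleftrightarrow> s - t \<in> \<int>"
  by transfer simp

lemma open_int_dist_less: "open {t. int_dist t < e}"
proof -
  have "{t. int_dist t < e} = (\<Union>k. {t. \<bar>t - of_int k\<bar> < e})"
    by (auto intro: le_less_trans[OF int_dist_le]) (auto simp: int_dist_def)
  moreover have "open {t. \<bar>t - of_int k\<bar> < e}" for k
    by (intro open_Collect_less continuous_intros)
  ultimately show ?thesis
    by auto
qed

text \<open>The images of the sets \<open>{t. int_dist t < e}\<close> form a neighbourhood base of 0
  in the quotient topology.\<close>

lemma tendsto_proj_0_iff:
  "((\<lambda>n. proj (f n)) \<longlongrightarrow> 0) F \<longleftrightarrow> ((\<lambda>n. int_dist (f n)) \<longlongrightarrow> 0) F"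
proof
  assume lim: "((\<lambda>n. proj (f n)) \<longlongrightarrow> 0) F"
  show "((\<lambda>n. int_dist (f n)) \<longlongrightarrow> 0) F"
  proof (rule tendstoI)
    fix e :: real
    assume "e > 0"
    let ?V = "proj ` {t. int_dist t < e}"
    \<comment> \<open>\<open>int_dist\<close> is constant on classes modulo 1, so the preimage of
      \<open>?V\<close> is the open set it came from; hence \<open>?V\<close> is open.\<close>
    have mem: "proj t \<in> ?V \<longleftrightarrow> int_dist t < e" for t
    proof
      assume "proj t \<in> ?V"
      then obtain s where "int_dist s < e" "t - s \<in> \<int>"
        by (auto simp: proj_eq_iff)
      moreover from this(2) obtain k where "t - s = of_int k"
        by (rule Ints_cases)
      ultimately show "int_dist t < e"
        using int_dist_le_add[of t s k] by simp
    qed auto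
    then have "proj -` ?V = {t. int_dist t < e}"
      by auto
    then have "open ?V"
      by (simp add: open_circle_def open_int_dist_less)
    moreover have "0 \<in> ?V"
      using \<open>e > 0\<close> mem[of 0] by (simp add: int_dist_def zero_circle_def proj_def)
    ultimately show "eventually (\<lambda>n. dist (int_dist (f n)) 0 < e) F"
      using topological_tendstoD[OF lim, of ?V] by (simp add: mem int_dist_nonneg)
  qed
next
  assume lim: "((\<lambda>n. int_dist (f n)) \<longlongrightarrow> 0) F"
  show "((\<lambda>n. proj (f n)) \<longlongrightarrow> 0) F"
  proof (rule topological_tendstoI)
    fix V :: "circle set"
    assume "open V" "0 \<in> V"
    have "proj 0 = 0"
      by transfer simp
    then obtain e where "e > 0" and e: "\<And>t. \<bar>t\<bar> < e \<Longrightarrow> proj t \<in> V"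
      using \<open>open V\<close> \<open>0 \<in> V\<close> by (force simp: open_circle_def open_dist dist_real_def)
    \<comment> \<open>Subtracting the nearest integer moves \<open>t\<close> into the
      \<open>e\<close>-ball about 0 without changing its class.\<close>
    have "proj t \<in> V" if "int_dist t < e" for t
    proof -
      have "proj t = proj (t - of_int (round t))"
        by (simp add: proj_eq_iff)
      then show ?thesis
        using that e by (simp add: int_dist_def)
    qed
    then show "eventually (\<lambda>n. proj (f n) \<in> V) F"
      using tendstoD[OF lim \<open>e > 0\<close>] by (auto simp: int_dist_nonneg elim: eventually_mono)
  qed
qed

section \<open>The dual filter of an ideal\<close>

text \<open>For an ideal \<open>I\<close>, this turns \<open>ideal_converges\<close> into an
  ordinary \<open>tendsto\<close>; the filter is trivial when \<open>UNIV \<in> I\<close>.\<close>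

definition ideal_filter :: "nat set set \<Rightarrow> nat filter"
  where "ideal_filter I = Abs_filter (\<lambda>P. {n. \<not> P n} \<in> I)"

lemma eventually_ideal_filter:
  assumes "is_ideal I"
  shows "eventually P (ideal_filter I) \<longleftrightarrow> {n. \<not> P n} \<in> I"
  unfolding ideal_filter_def
proof (rule eventually_Abs_filter, unfold_locales)
  have union: "A \<union> B \<in> I" if "A \<in> I" "B \<in> I" for A B
    using assms that by (auto simp: is_ideal_def)
  have subset: "B \<in> I" if "A \<in> I" "B \<subseteq> A" for A B
    using assms that unfolding is_ideal_def by blast
  show "{n. \<not> True} \<in> I"
    using assms subset by (auto simp: is_ideal_def)
  show "{n. \<not> (P n \<and> Q n)} \<in> I" if "{n. \<not> P n} \<in> I" "{n. \<not> Q n} \<in> I" for P Q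
    by (rule subset[OF union[OF that]]) auto
  show "{n. \<not> Q n} \<in> I" if "\<forall>n. P n \<longrightarrow> Q n" "{n. \<not> P n} \<in> I" for P Q
    by (rule subset[OF that(2)]) (use that(1) in auto)
qed

lemma ideal_converges_iff:
  assumes "is_ideal I"
  shows "ideal_converges I f l \<longleftrightarrow> (f \<longlongrightarrow> l) (ideal_filter I)"
proof
  assume "ideal_converges I f l"
  then show "(f \<longlongrightarrow> l) (ideal_filter I)"
    by (intro topological_tendstoI) (auto simp: ideal_converges_def eventually_ideal_filter[OF assms])
next
  assume lim: "(f \<longlongrightarrow> l) (ideal_filter I)"
  show "ideal_converges I f l"
    unfolding ideal_converges_def
  proof (intro allI impI)
    fix U
    assume "\<exists>V. open V \<and> l \<in> V \<and> V \<subseteq> U"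
    then obtain V where "open V" "l \<in> V" "V \<subseteq> U"
      by blast
    then have "eventually (\<lambda>n. f n \<in> U) (ideal_filter I)"
      by (auto intro: eventually_mono[OF topological_tendstoD[OF lim]])
    then show "{n. f n \<notin> U} \<in> I"
      by (simp add: eventually_ideal_filter[OF assms])
  qed
qed

lemma eventually_along:
  "eventually P (along A) \<longleftrightarrow> finite {n \<in> A. \<not> P n}"
  unfolding along_def eventually_inf_principal
  by (simp flip: cofinite_eq_sequentially add: eventually_cofinite)

lemma along_mono: "A \<subseteq> B \<Longrightarrow> along A \<le> along B"
  unfolding along_def by (intro inf_mono) auto

text \<open>Exceptions to a property that holds eventually along \<open>A\<close> lie in
  \<open>- A\<close> and a finite set, the latter in \<open>I\<close> by freeness.\<close>

lemma ideal_filter_le_along: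
  assumes "free_ideal I" "- A \<in> I"
  shows "ideal_filter I \<le> along A"
proof (rule filter_leI)
  fix P
  assume "eventually P (along A)"
  then have "finite {n \<in> A. \<not> P n}"
    by (simp add: eventually_along)
  then have *: "- A \<union> {n \<in> A. \<not> P n} \<in> I"
    using assms by (auto simp: free_ideal_def is_ideal_def)
  have ideal: "is_ideal I"
    using assms(1) by (simp add: free_ideal_def)
  have "{n. \<not> P n} \<subseteq> - A \<union> {n \<in> A. \<not> P n}"
    by auto
  then have "{n. \<not> P n} \<in> I"
    using * ideal by (simp add: is_ideal_def)
  with ideal show "eventually P (ideal_filter I)"
    by (simp add: eventually_ideal_filter)
qed

text \<open>The P-property, applied to the countably many exceptional sets, gives one
  \<open>U\<close> containing each of them up to finitely many points.\<close>

lemma P_ideal_eventually_along: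
  fixes P :: "nat \<Rightarrow> nat \<Rightarrow> bool"
  assumes "P_ideal I" and ev: "\<And>k. eventually (P k) (ideal_filter I)"
  obtains U where "U \<in> I" "\<And>k. eventually (P k) (along (- U))"
proof -
  have "{n. \<not> P k n} \<in> I" for k
    using ev assms(1) by (simp add: eventually_ideal_filter P_ideal_def)
  with \<open>P_ideal I\<close> obtain U where "U \<in> I" and fin: "\<And>k. finite ({n. \<not> P k n} - U)"
    unfolding P_ideal_def by (auto dest!: conjunct2 spec[of _ "\<lambda>k. {n. \<not> P k n}"])
  moreover have "eventually (P k) (along (- U))" for k
    unfolding eventually_along by (rule finite_subset[OF _ fin[of k]]) auto
  ultimately show thesis
    using that by blast
qed

text \<open>Tending to 0 amounts to countably many eventual conditions, with tolerances
  \<open>1 / real (Suc k)\<close>, so a single \<open>U\<close> serves all of them.\<close>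

lemma P_ideal_tendsto_0_along:
  fixes f :: "nat \<Rightarrow> real"
  assumes "P_ideal I" and lim: "(f \<longlongrightarrow> 0) (ideal_filter I)"
  obtains U where "U \<in> I" "(f \<longlongrightarrow> 0) (along (- U))"
proof -
  have "eventually (\<lambda>n. dist (f n) 0 < 1 / real (Suc k)) (ideal_filter I)" for k
    by (rule tendstoD[OF lim]) simp
  then obtain U where "U \<in> I"
    and U: "\<And>k. eventually (\<lambda>n. dist (f n) 0 < 1 / real (Suc k)) (along (- U))"
    by (rule P_ideal_eventually_along[OF \<open>P_ideal I\<close>,
          where P = "\<lambda>k n. dist (f n) 0 < 1 / real (Suc k)"]) blast+
  have "(f \<longlongrightarrow> 0) (along (- U))"
  proof (rule tendstoI)
    fix e :: real
    assume "e > 0"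
    then obtain k where "1 / real (Suc k) < e"
      using nat_approx_posE by blast
    then show "eventually (\<lambda>n. dist (f n) 0 < e) (along (- U))"
      by (intro eventually_mono[OF U[of k]]) simp
  qed
  with \<open>U \<in> I\<close> show thesis
    using that by blast
qed

lemma P_ideal_at_top_along:
  fixes f :: "nat \<Rightarrow> int"
  assumes "P_ideal I" and lim: "filterlim f at_top (ideal_filter I)"
  obtains U where "U \<in> I" "filterlim f at_top (along (- U))"
proof -
  have "eventually (\<lambda>n. int k \<le> f n) (ideal_filter I)" for k
    using lim by (simp add: filterlim_at_top)
  then obtain U where "U \<in> I" and U: "\<And>k. eventually (\<lambda>n. int k \<le> f n) (along (- U))"
    by (rule P_ideal_eventually_along[OF \<open>P_ideal I\<close>, where P = "\<lambda>k n. int k \<le> f n"]) blast+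
  have "filterlim f at_top (along (- U))"
    unfolding filterlim_at_top
  proof
    fix M
    show "eventually (\<lambda>n. M \<le> f n) (along (- U))"
      \<comment> \<open>\<open>nat M\<close> is a natural threshold at least \<open>M\<close>, also
        for negative \<open>M\<close>.\<close>
      by (rule eventually_mono[OF U[of "nat M"]]) linarith
  qed
  with \<open>U \<in> I\<close> show thesis
    using that by blast
qed

text \<open>The two exceptional sets are translates of each other by 1, apart from the index
  0.\<close>

lemma eventually_ideal_filter_Suc:
  assumes "free_ideal I" "translation_invariant I"
  shows "eventually (\<lambda>n. P (Suc n)) (ideal_filter I) \<longleftrightarrow> eventually P (ideal_filter I)"
proof -
  have ideal: "is_ideal I" and fin: "{0} \<in> I"
    using assms(1) by (auto simp: free_ideal_def)
  have "{n. \<not> P n} \<in> I" if "{n. \<not> P (Suc n)} \<in> I"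
  proof -
    \<comment> \<open>Translation by 1 never reaches the index 0, so \<open>{0}\<close> is added by
      hand.\<close>
    have "shift {n. \<not> P (Suc n)} 1 \<union> {0} \<in> I"
      using ideal fin that assms(2) unfolding is_ideal_def translation_invariant_def by blast
    moreover have "{n. \<not> P n} \<subseteq> shift {n. \<not> P (Suc n)} 1 \<union> {0}"
    proof
      fix n
      assume "n \<in> {n. \<not> P n}"
      then show "n \<in> shift {n. \<not> P (Suc n)} 1 \<union> {0}"
        by (cases n) (auto simp: shift_def)
    qed
    ultimately show ?thesis
      using ideal unfolding is_ideal_def by blast
  qed
  moreover have "{n. \<not> P (Suc n)} \<in> I" if "{n. \<not> P n} \<in> I"
  proof -
    have "shift {n. \<not> P n} (- 1) \<in> I"
      using that assms(2) by (simp add: translation_invariant_def)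
    moreover have "{n. \<not> P (Suc n)} \<subseteq> shift {n. \<not> P n} (- 1)"
      by (force simp: shift_def)
    ultimately show ?thesis
      using ideal unfolding is_ideal_def by blast
  qed
  ultimately show ?thesis
    by (auto simp: eventually_ideal_filter[OF ideal])
qed

lemma filterlim_ideal_filter_Suc:
  assumes "free_ideal I" "translation_invariant I"
  shows "filterlim (\<lambda>n. f (Suc n)) G (ideal_filter I) \<longleftrightarrow> filterlim f G (ideal_filter I)"
  unfolding filterlim_iff
  by (subst eventually_ideal_filter_Suc[OF assms, of "\<lambda>n. P (f n)" for P]) (rule refl)

section \<open>Arithmetic sequences and digits\<close>

lemma arithmetic_seq_pos:
  assumes "arithmetic_seq u"
  shows "u n > 0"
proof -
  have "u 0 \<le> u n"
    using assms strict_mono_less_eq[of u 0 n] by (simp add: arithmetic_seq_def)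
  then show ?thesis
    using assms by (simp add: arithmetic_seq_def)
qed

lemma arithmetic_seq_Suc:
  assumes "arithmetic_seq u"
  shows "u (Suc n) = ratio u (Suc n) * u n"
  using assms by (simp add: arithmetic_seq_def ratio_def)

lemma ratio_Suc_pos:
  assumes "arithmetic_seq u"
  shows "ratio u (Suc n) > 0"
  using arithmetic_seq_Suc[OF assms, of n] arithmetic_seq_pos[OF assms, of n]
    arithmetic_seq_pos[OF assms, of "Suc n"]
  by (metis zero_less_mult_pos2)

text \<open>For each \<open>M\<close>, the indices with ratio below \<open>M\<close> form a
  \<open>b\<close>-bounded set, hence a member of \<open>I\<close>.\<close>

lemma filterlim_ratio_ideal_filter:
  assumes "is_ideal I" "bounded_sets u \<subseteq> I"
  shows "filterlim (ratio u) at_top (ideal_filter I)"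
  unfolding filterlim_at_top
proof
  fix M
  have "{n. \<not> M \<le> ratio u n} \<in> bounded_sets u"
    by (auto simp: bounded_sets_def b_bounded_def intro!: exI[of _ M])
  then show "eventually (\<lambda>n. M \<le> ratio u n) (ideal_filter I)"
    using assms by (auto simp: eventually_ideal_filter)
qed

definition digit_sum :: "(nat \<Rightarrow> int) \<Rightarrow> (nat \<Rightarrow> nat) \<Rightarrow> nat \<Rightarrow> real"
  where "digit_sum u c n = (\<Sum>k<n. real (c (Suc k)) / of_int (u (Suc k)))"

text \<open>Each of the denominators \<open>u 1\<close>, ..., \<open>u n\<close> divides
  \<open>u n\<close>. Thus modulo 1 only the tail of the series contributes to
  \<open>u n * x\<close>.\<close>

lemma digit_sum_mult_Ints:
  assumes "arithmetic_seq u"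
  shows "of_int (u n) * digit_sum u c n \<in> \<int>"
proof (induction n)
  case (Suc n)
  have "of_int (u (Suc n)) * digit_sum u c (Suc n)
      = of_int (ratio u (Suc n)) * (of_int (u n) * digit_sum u c n) + of_nat (c (Suc n))"
    using arithmetic_seq_pos[OF assms, of "Suc n"] arithmetic_seq_Suc[OF assms, of n]
    by (auto simp: digit_sum_def distrib_left)
  then show ?case
    using Suc by simp
qed (simp add: digit_sum_def)

text \<open>Nested intervals: the left ends increase, the right ends decrease because a digit plus 1
  is at most the ratio, and the left ends tend to \<open>x\<close>.\<close>

lemma digit_sum_bounds:
  assumes u: "arithmetic_seq u" and c: "canonical_digits u x c"
  shows "digit_sum u c n \<le> x" "x \<le> digit_sum u c n + 1 / of_int (u n)"
proof -
  have pos: "u k > 0" for k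
    by (rule arithmetic_seq_pos[OF u])
  have lim: "digit_sum u c \<longlonglongrightarrow> x"
    using c by (simp add: canonical_digits_def sums_def digit_sum_def[abs_def])
  have "incseq (digit_sum u c)"
    using pos by (intro incseq_SucI) (simp add: digit_sum_def less_imp_le)
  then show "digit_sum u c n \<le> x"
    using lim by (rule incseq_le)
  have "decseq (\<lambda>k. digit_sum u c k + 1 / of_int (u k))"
  proof (rule decseq_SucI)
    fix k
    have "int (c (Suc k)) + 1 \<le> ratio u (Suc k)"
      using c by (auto simp: canonical_digits_def dest: spec[of _ "Suc k"])
    then have "real_of_int (int (c (Suc k)) + 1) \<le> of_int (ratio u (Suc k))"
      by (simp only: of_int_le_iff)
    then have "(real (c (Suc k)) + 1) / of_int (u (Suc k))
        \<le> of_int (ratio u (Suc k)) / of_int (u (Suc k))"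
      using pos[of "Suc k"] by (intro divide_right_mono) auto
    also have "\<dots> = 1 / of_int (u k)"
      using ratio_Suc_pos[OF u, of k] pos[of k] by (simp add: arithmetic_seq_Suc[OF u, of k])
    finally show "digit_sum u c (Suc k) + 1 / of_int (u (Suc k))
        \<le> digit_sum u c k + 1 / of_int (u k)"
      by (simp add: digit_sum_def add_divide_distrib)
  qed
  \<comment> \<open>Each later partial sum lies below its own right end, hence below the one at
    \<open>n\<close>; the bound passes to the limit.\<close>
  then have "digit_sum u c k \<le> digit_sum u c n + 1 / of_int (u n)" if "k \<ge> n" for k
    using decseqD[OF _ that] pos[of k]
    by (smt (verit) of_int_0_less_iff zero_less_divide_1_iff)
  then show "x \<le> digit_sum u c n + 1 / of_int (u n)"
    using LIMSEQ_le_const2[OF lim] by blast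
qed

text \<open>After multiplication by \<open>u n\<close>, the first \<open>n\<close> terms give the
  integer \<open>k\<close>, the next term gives the digit quotient, and the tail is at most
  \<open>u n / u (Suc n)\<close>, the reciprocal of the ratio.\<close>

lemma multiple_near_digit_ratio:
  assumes u: "arithmetic_seq u" and c: "canonical_digits u x c"
  obtains k :: int where
    "\<bar>of_int (u n) * x - real (c (Suc n)) / of_int (ratio u (Suc n)) - of_int k\<bar>
      \<le> 1 / of_int (ratio u (Suc n))"
proof -
  let ?b = "real_of_int (ratio u (Suc n))" and ?u = "real_of_int (u n)"
  obtain k :: int where k: "?u * digit_sum u c n = of_int k"
    using digit_sum_mult_Ints[OF u, of n c] by (auto elim: Ints_cases)
  have pos: "?u > 0" "?b > 0"
    using arithmetic_seq_pos[OF u] ratio_Suc_pos[OF u] by auto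
  have uSuc: "real_of_int (u (Suc n)) = ?b * ?u"
    by (simp add: arithmetic_seq_Suc[OF u, of n])
  have "?u * digit_sum u c (Suc n) = of_int k + real (c (Suc n)) / ?b"
    using pos by (simp add: digit_sum_def uSuc distrib_left flip: k)
  then have *: "?u * x - real (c (Suc n)) / ?b - of_int k = ?u * (x - digit_sum u c (Suc n))"
    by (simp add: right_diff_distrib)
  have "?u * (x - digit_sum u c (Suc n)) \<le> ?u * (1 / of_int (u (Suc n)))"
    using digit_sum_bounds(2)[OF u c, of "Suc n"] pos by (intro mult_left_mono) auto
  also have "\<dots> = 1 / ?b"
    using pos by (simp add: uSuc)
  finally have "?u * (x - digit_sum u c (Suc n)) \<le> 1 / ?b" .
  moreover have "0 \<le> ?u * (x - digit_sum u c (Suc n))"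
    using digit_sum_bounds(1)[OF u c, of "Suc n"] pos by simp
  ultimately show thesis
    using that[of k] by (simp add: *)
qed

lemma int_mult_proj: "int_mult k (proj t) = proj (of_int k * t)"
  by transfer simp

lemma proj_in_t_set_iff:
  assumes u: "arithmetic_seq u" and I: "free_ideal I" "translation_invariant I"
    and b: "bounded_sets u \<subseteq> I" and c: "canonical_digits u x c"
  shows "proj x \<in> t_set I u \<longleftrightarrow>
    ((\<lambda>n. int_dist (real (c n) / of_int (ratio u n))) \<longlongrightarrow> 0) (ideal_filter I)"
proof -
  let ?F = "ideal_filter I"
  let ?f = "\<lambda>n. int_dist (of_int (u n) * x)"
    and ?g = "\<lambda>n. int_dist (real (c n) / of_int (ratio u n))"
  have ideal: "is_ideal I"
    using I(1) by (simp add: free_ideal_def)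
  have "filterlim (\<lambda>n. ratio u (Suc n)) at_top ?F"
    using filterlim_ratio_ideal_filter[OF ideal b]
    by (simp add: filterlim_ideal_filter_Suc[OF I])
  then have "filterlim (\<lambda>n. real_of_int (ratio u (Suc n))) at_top ?F"
    by (rule filterlim_compose[OF filterlim_real_of_int_at_top])
  then have lim: "((\<lambda>n. 1 / real_of_int (ratio u (Suc n))) \<longlongrightarrow> 0) ?F"
    by (intro tendsto_divide_0[OF tendsto_const] filterlim_at_top_imp_at_infinity)
  \<comment> \<open>The unknown integer disappears because \<open>int_dist\<close> is 1-Lipschitz
    modulo integers.\<close>
  have "\<bar>?f n - ?g (Suc n)\<bar> \<le> 1 / of_int (ratio u (Suc n))" for n
    by (rule multiple_near_digit_ratio[OF u c, of n]) (rule order_trans[OF abs_int_dist_diff_le])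
  then have "((\<lambda>n. ?f n - ?g (Suc n)) \<longlongrightarrow> 0) ?F"
    using ratio_Suc_pos[OF u]
    by (intro tendsto_0_le[OF lim, where K = 1] always_eventually) (simp add: abs_of_pos)
  then have "(?f \<longlongrightarrow> 0) ?F \<longleftrightarrow> ((\<lambda>n. ?g (Suc n)) \<longlongrightarrow> 0) ?F"
    by (rule Lim_transform_eq)
  also have "\<dots> \<longleftrightarrow> (?g \<longlongrightarrow> 0) ?F"
    by (rule filterlim_ideal_filter_Suc[OF I])
  finally show ?thesis
    by (simp add: t_set_def ideal_converges_iff[OF ideal] int_mult_proj tendsto_proj_0_iff)
qed

theorem corollary1p11:
  fixes u :: "nat \<Rightarrow> int" and I :: "nat set set" and x :: real and c :: "nat \<Rightarrow> nat"
  assumes "arithmetic_seq u"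
    and "free_ideal I" and "translation_invariant I" and "P_ideal I"
    and "bounded_sets u \<subseteq> I"
    and "x \<in> {0..<1}"
    and "canonical_digits u x c"
  shows "proj x \<in> t_set I u \<longleftrightarrow>
    (\<forall>A. b_divergent u A \<and> A \<notin> I \<longrightarrow>
      (\<exists>B. subset_mod I B A \<and>
        ((\<lambda>n. proj (real (c n) / real_of_int (ratio u n))) \<longlongrightarrow> 0) (along B)))"
proof -
  let ?g = "\<lambda>n. int_dist (real (c n) / real_of_int (ratio u n))"
  have ideal: "is_ideal I"
    using assms by (simp add: free_ideal_def)
  have union: "A \<union> B \<in> I" if "A \<in> I" "B \<in> I" for A B
    using ideal that by (simp add: is_ideal_def)
  have subset: "B \<in> I" if "A \<in> I" "B \<subseteq> A" for A B
    using ideal that unfolding is_ideal_def by blast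
  have "(?g \<longlongrightarrow> 0) (ideal_filter I) \<longleftrightarrow>
    (\<forall>A. b_divergent u A \<and> A \<notin> I \<longrightarrow> (\<exists>B. subset_mod I B A \<and> (?g \<longlongrightarrow> 0) (along B)))"
    (is "?L \<longleftrightarrow> ?R")
  proof
    assume ?L
    then obtain U where "U \<in> I" and U: "(?g \<longlongrightarrow> 0) (along (- U))"
      using P_ideal_tendsto_0_along[OF assms(4)] by blast
    show ?R
    proof (intro allI impI)
      fix A
      \<comment> \<open>One \<open>U\<close> serves every \<open>A\<close>: the discarded part
        \<open>A \<inter> U\<close> lies in \<open>I\<close>.\<close>
      have "subset_mod I (A - U) A"
        using subset[OF \<open>U \<in> I\<close>, of "A - (A - U)"] by (auto simp: subset_mod_def)
      moreover have "(?g \<longlongrightarrow> 0) (along (A - U))"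
        by (rule tendsto_mono[OF along_mono U]) auto
      ultimately show "\<exists>B. subset_mod I B A \<and> (?g \<longlongrightarrow> 0) (along B)"
        by blast
    qed
  next
    assume R: ?R
    obtain U where "U \<in> I" and U: "filterlim (ratio u) at_top (along (- U))"
      using P_ideal_at_top_along[OF assms(4) filterlim_ratio_ideal_filter[OF ideal assms(5)]] .
    obtain B where "- B \<in> I" and B: "(?g \<longlongrightarrow> 0) (along B)"
    \<comment> \<open>The condition \<open>?R\<close> speaks only of sets outside \<open>I\<close>.
      If \<open>- U\<close> is in \<open>I\<close>, then so is \<open>UNIV\<close>, and
      \<open>{}\<close> serves as \<open>B\<close>, since limits along it are trivial.\<close>
    proof (cases "- U \<in> I")
      case True
      then have "- {} \<in> I"
        using union[OF \<open>U \<in> I\<close> True] by simp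
      moreover have "(?g \<longlongrightarrow> 0) (along {})"
        by (simp add: along_def)
      ultimately show thesis
        using that by blast
    next
      case False
      then obtain B where "subset_mod I B (- U)" "(?g \<longlongrightarrow> 0) (along B)"
        using R U by (auto simp: b_divergent_def)
      \<comment> \<open>\<open>- B\<close> is covered by \<open>U\<close> and
        \<open>- U - B\<close>, both members of \<open>I\<close>.\<close>
      moreover from this(1) have "- B \<in> I"
        using subset[OF union[OF \<open>U \<in> I\<close>, of "- U - B"], of "- B"]
        by (auto simp: subset_mod_def)
      ultimately show thesis
        using that by blast
    qed
    show ?L
      by (rule tendsto_mono[OF ideal_filter_le_along[OF assms(2) \<open>- B \<in> I\<close>] B])
  qed
  then show ?thesis
    using proj_in_t_set_iff[OF assms(1-3,5,7)] by (simp add: tendsto_proj_0_iff)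
qed

end
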